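(* Let $(X,d)$ be a metric space, let $D_n\subset X$ and $f_n:D_n\to D_{n+1}$ be maps for $n\ge 0$, and consider the non-autonomous system $x_{n+1}=f_n(x_n)$, $n\ge 0$. Let $V$ be a totally invariant set of this system and let $\{f_n\}_{n=0}^\infty$ converge (pointwise) to a map $f$ in $V$. If $f_n$ for all $n\ge 0$ and $f$ are continuous in $V$, and $P(f_{0,\infty})\cap V$ is dense in $V$, then: (i) $f_0^n=f^n$ in $V$ for each $n\ge 1$; (ii) topological transitivity of the system $x_{n+1}=f_n(x_n)$ in $V$ is equivalent to topological transitivity of the autonomous system $x_{n+1}=f(x_n)$ in $V$; (iii) sensitivity of the system $x_{n+1}=f_n(x_n)$ in $V$ is equivalent to sensitivity of the autonomous system $x_{n+1}=f(x_n)$ in $V$.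
   Context: Notation: $f_0^0=\mathrm{id}$ and $f_0^n=f_{n-1}\circ\cdots\circ f_0$ on $D_0$ for $n\ge1$. $f^n$ is the $n$-th iterate of $f$ (an assertion about $f^n$ at a point of $V$ includes that the iterates involved are defined, i.e., that the preceding iterates lie in $V$). A nonempty set $V\subset\bigcap_{n=0}^\infty D_n$ is a totally invariant set of the system if $f_0^n(V)\subset V$ for all $n\ge 0$. "Converges to $f$ in $V$" means $f:V\to X$ and $f_n(x)\to f(x)$ for each $x\in V$; "continuous in $V$" refers to the map restricted to $V$. A point $p\in D_0$ is $k$-periodic ($k\ge 1$) if $f_0^{n+k}(p)=f_0^n(p)$ for all $n\ge 0$; $P(f_{0,\infty})$ is the set of all periodic points (i.e., $k$-periodic for some $k\geq 1$). The system $x_{n+1}=f_n(x_n)$ is topologically transitive in $V$ if for any two nonempty relatively open subsets $U_0,V_0$ of $V$ there is an integer $n\ge 1$ with $f_0^n(U_0)\cap V_0\ne\emptyset$. It is sensitive in $V$ if there is a constant $\delta_0>0$ such that for every $x_0\in V$ and every neighborhood $U$ of $x_0$ there exist $y_0\in V\cap U$ and a positive integer $n$ with $d(f_0^n(x_0),f_0^n(y_0))>\delta_0$. For the autonomous system $x_{n+1}=f(x_n)$ the definitions are the same with $f_0^n$ replaced by $f^n$. *)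

theory Defs
  imports "HOL-Analysis.Analysis"
begin

text \<open>
  The metric space \<open>X\<close> is a type of class \<^class>\<open>metric_space\<close>. Maps that are only given on a
  subset of \<open>X\<close> (\<open>f\<^sub>n\<close> on \<open>D\<^sub>n\<close>, \<open>f\<close> on \<open>V\<close>) are total functions whose values outside that
  subset are arbitrary; the notions below are arranged so as never to depend on those values.
\<close>

definition nonautonomous_system :: "(nat \<Rightarrow> 'a set) \<Rightarrow> (nat \<Rightarrow> 'a \<Rightarrow> 'a) \<Rightarrow> bool" where
  "nonautonomous_system D fs \<longleftrightarrow> (\<forall>n. fs n \<in> D n \<rightarrow> D (Suc n))"

primrec orbit_map :: "(nat \<Rightarrow> 'a \<Rightarrow> 'a) \<Rightarrow> nat \<Rightarrow> 'a \<Rightarrow> 'a" where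
  "orbit_map fs 0 = id"
| "orbit_map fs (Suc n) = fs n \<circ> orbit_map fs n"

definition totally_invariant :: "(nat \<Rightarrow> 'a set) \<Rightarrow> (nat \<Rightarrow> 'a \<Rightarrow> 'a) \<Rightarrow> 'a set \<Rightarrow> bool" where
  "totally_invariant D fs V \<longleftrightarrow>
     V \<noteq> {} \<and> V \<subseteq> (\<Inter>n. D n) \<and> (\<forall>n. orbit_map fs n ` V \<subseteq> V)"

definition periodic_point ::
    "(nat \<Rightarrow> 'a set) \<Rightarrow> (nat \<Rightarrow> 'a \<Rightarrow> 'a) \<Rightarrow> nat \<Rightarrow> 'a \<Rightarrow> bool" where
  "periodic_point D fs k p \<longleftrightarrow>
     k \<ge> 1 \<and> p \<in> D 0 \<and> (\<forall>n. orbit_map fs (n + k) p = orbit_map fs n p)"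

definition periodic_points :: "(nat \<Rightarrow> 'a set) \<Rightarrow> (nat \<Rightarrow> 'a \<Rightarrow> 'a) \<Rightarrow> 'a set" where
  "periodic_points D fs = {p. \<exists>k. periodic_point D fs k p}"

text \<open>
  Since \<open>f\<close> maps \<open>V\<close> into \<open>X\<close>, not necessarily into \<open>V\<close>, its iterates are partial:
  \<open>f\<^sup>n\<close> is defined at \<open>x\<close> iff \<open>x, f x, \<dots>\<close>, up to the \<open>(n-1)\<close>-st iterate, all lie in \<open>V\<close>.
\<close>

definition iterate_domain :: "'a set \<Rightarrow> ('a \<Rightarrow> 'a) \<Rightarrow> nat \<Rightarrow> 'a set" where
  "iterate_domain V f n = {x. \<forall>j<n. (f ^^ j) x \<in> V}"

text \<open>
  Transitivity and sensitivity are stated for a family of partial maps \<open>F n\<close> with domains \<open>E n\<close>,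
  covering both kinds of system: the non-autonomous one is \<open>E n = D 0\<close>, \<open>F = orbit_map fs\<close>, the
  autonomous one is \<open>E = iterate_domain V f\<close>, \<open>F n = f ^^ n\<close>.
\<close>

definition topologically_transitive_in ::
    "'a::metric_space set \<Rightarrow> (nat \<Rightarrow> 'a set) \<Rightarrow> (nat \<Rightarrow> 'a \<Rightarrow> 'a) \<Rightarrow> bool" where
  "topologically_transitive_in V E F \<longleftrightarrow>
     (\<forall>U W. openin (top_of_set V) U \<longrightarrow> U \<noteq> {} \<longrightarrow> openin (top_of_set V) W \<longrightarrow> W \<noteq> {} \<longrightarrow>
        (\<exists>n\<ge>1. F n ` (U \<inter> E n) \<inter> W \<noteq> {}))"

definition sensitive_in ::
    "'a::metric_space set \<Rightarrow> (nat \<Rightarrow> 'a set) \<Rightarrow> (nat \<Rightarrow> 'a \<Rightarrow> 'a) \<Rightarrow> bool" where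
  "sensitive_in V E F \<longleftrightarrow>
     (\<exists>\<delta>>0. \<forall>x\<in>V. \<forall>U. x \<in> interior U \<longrightarrow>
        (\<exists>y\<in>V \<inter> U. \<exists>n\<ge>1. x \<in> E n \<and> y \<in> E n \<and> dist (F n x) (F n y) > \<delta>))"

end

theory Submission
  imports Defs
begin

text \<open>
  Along the orbit of a \<open>k\<close>-periodic point \<open>p\<close>, every \<open>f\<^sub>n\<^sub>+\<^sub>m\<^sub>k\<close> sends \<open>f\<^sub>0\<^sup>n(p)\<close> to \<open>f\<^sub>0\<^sup>n\<^sup>+\<^sup>1(p)\<close>, so
  letting \<open>m\<close> tend to infinity gives \<open>f (f\<^sub>0\<^sup>n(p)) = f\<^sub>0\<^sup>n\<^sup>+\<^sup>1(p)\<close>. By density and continuity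
  \<open>f \<circ> f\<^sub>0\<^sup>n = f\<^sub>0\<^sup>n\<^sup>+\<^sup>1\<close> on all of \<open>V\<close>, whence \<open>f\<^sub>0\<^sup>n = f\<^sup>n\<close> there. Transitivity and sensitivity only
  involve the values of the iterates on \<open>V\<close>.
\<close>

text \<open>A sequence in \<open>S\<close> tending to \<open>x\<close> has the same images under
  \<open>g\<close> and \<open>h\<close>, and limits in a metric space are unique.\<close>

lemma continuous_on_eq_of_dense_subset:
  fixes g h :: "'a::metric_space \<Rightarrow> 'b::metric_space"
  assumes "continuous_on V g" "continuous_on V h"
    and "S \<subseteq> V" "V \<subseteq> closure S" "\<And>x. x \<in> S \<Longrightarrow> g x = h x" "x \<in> V"
  shows "g x = h x"
proof -
  obtain s where s: "\<And>n. s n \<in> S" "s \<longlonglongrightarrow> x"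
    using assms(4,6) closure_sequential by blast
  have "(\<lambda>n. g (s n)) \<longlonglongrightarrow> g x" "(\<lambda>n. h (s n)) \<longlonglongrightarrow> h x"
    using s assms(3)
    by (auto intro!: continuous_on_tendsto_compose[OF assms(1)]
        continuous_on_tendsto_compose[OF assms(2)] assms(6) always_eventually)
  moreover have "(\<lambda>n. g (s n)) = (\<lambda>n. h (s n))"
    using s(1) assms(5) by auto
  ultimately show ?thesis
    using LIMSEQ_unique by metis
qed

lemma orbit_map_in:
  assumes "totally_invariant D fs V" "x \<in> V"
  shows "orbit_map fs n x \<in> V"
  using assms unfolding totally_invariant_def by blast

lemma continuous_on_orbit_map:
  fixes fs :: "nat \<Rightarrow> 'a::topological_space \<Rightarrow> 'a"
  assumes "totally_invariant D fs V" "\<And>n. continuous_on V (fs n)"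
  shows "continuous_on V (orbit_map fs n)"
proof (induction n)
  case (Suc n)
  have "orbit_map fs n ` V \<subseteq> V"
    using assms(1) unfolding totally_invariant_def by blast
  then show ?case
    using continuous_on_compose2[OF assms(2) Suc] by (simp add: o_def)
qed (simp add: id_def)

lemma limit_map_periodic_orbit:
  fixes fs :: "nat \<Rightarrow> 'a::metric_space \<Rightarrow> 'a"
  assumes p: "periodic_point D fs k p"
    and lim: "(\<lambda>m. fs m (orbit_map fs n p)) \<longlonglongrightarrow> l"
  shows "orbit_map fs (Suc n) p = l"
proof -
  have k: "k \<ge> 1" and per: "orbit_map fs (i + k) p = orbit_map fs i p" for i
    using p unfolding periodic_point_def by auto
  have mult: "orbit_map fs (i + m * k) p = orbit_map fs i p" for i m
  proof (induction m)
    case (Suc m)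
    then show ?case
      using per[of "i + m * k"] by (simp add: algebra_simps)
  qed simp
  \<comment> \<open>\<open>mult\<close> at \<open>n\<close> identifies the argument of
    \<open>fs (n + m * k)\<close>, and at \<open>Suc n\<close> its value.\<close>
  have "fs (n + m * k) (orbit_map fs n p) = orbit_map fs (Suc n) p" for m
    using mult[of n m] mult[of "Suc n" m] by simp
  moreover have "strict_mono (\<lambda>m. n + m * k)"
    using k by (auto simp: strict_mono_def)
  then have "(\<lambda>m. fs (n + m * k) (orbit_map fs n p)) \<longlonglongrightarrow> l"
    using LIMSEQ_subseq_LIMSEQ[OF lim] by (simp add: o_def)
  ultimately show ?thesis
    by (simp add: LIMSEQ_const_iff)
qed

text \<open>Relatively open sets lie in \<open>V\<close>, which both domains contain for
  \<open>n \<ge> 1\<close>, so cutting \<open>U\<close> down to either domain changes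
  nothing.\<close>

lemma topologically_transitive_in_cong:
  assumes "\<And>n x. n \<ge> 1 \<Longrightarrow> x \<in> V \<Longrightarrow> x \<in> E n \<and> x \<in> E' n \<and> F n x = F' n x"
  shows "topologically_transitive_in V E F \<longleftrightarrow> topologically_transitive_in V E' F'"
proof -
  have "F n ` (U \<inter> E n) = F' n ` (U \<inter> E' n)" if "n \<ge> 1" "openin (top_of_set V) U" for n U
  proof -
    have "U \<subseteq> V"
      using that(2) openin_imp_subset by blast
    then have "U \<inter> E n = U" "U \<inter> E' n = U"
      using assms[OF that(1)] by auto
    then show ?thesis
      using assms[OF that(1)] \<open>U \<subseteq> V\<close> by (auto intro!: image_cong)
  qed
  then show ?thesis
    unfolding topologically_transitive_in_def by (metis (no_types, lifting))
qed

text \<open>The neighborhood \<open>U\<close> enters only through \<open>V \<inter> U\<close>, so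
  iterates are only compared at points of \<open>V\<close>.\<close>

lemma sensitive_in_cong:
  assumes "\<And>n x. n \<ge> 1 \<Longrightarrow> x \<in> V \<Longrightarrow> x \<in> E n \<and> x \<in> E' n \<and> F n x = F' n x"
  shows "sensitive_in V E F \<longleftrightarrow> sensitive_in V E' F'"
proof -
  have "(x \<in> E n \<and> y \<in> E n \<and> dist (F n x) (F n y) > \<delta>) \<longleftrightarrow>
      (x \<in> E' n \<and> y \<in> E' n \<and> dist (F' n x) (F' n y) > \<delta>)"
    if "n \<ge> 1" "x \<in> V" "y \<in> V" for n x y \<delta>
    using assms[OF that(1,2)] assms[OF that(1,3)] by simp
  then show ?thesis
    unfolding sensitive_in_def by (simp cong: conj_cong)
qed

theorem proposition4p1:
  fixes D :: "nat \<Rightarrow> 'a::metric_space set"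
    and fs :: "nat \<Rightarrow> 'a \<Rightarrow> 'a"
    and f :: "'a \<Rightarrow> 'a"
    and V :: "'a set"
  assumes "nonautonomous_system D fs"
    and "totally_invariant D fs V"
    and "\<And>x. x \<in> V \<Longrightarrow> (\<lambda>n. fs n x) \<longlonglongrightarrow> f x"
    and "\<And>n. continuous_on V (fs n)"
    and "continuous_on V f"
    and "V \<subseteq> closure (periodic_points D fs \<inter> V)"
  shows "(\<forall>n\<ge>1. \<forall>x\<in>V. x \<in> iterate_domain V f n \<and> orbit_map fs n x = (f ^^ n) x) \<and>
    (topologically_transitive_in V (\<lambda>_. D 0) (orbit_map fs) \<longleftrightarrow>
       topologically_transitive_in V (iterate_domain V f) (\<lambda>n. f ^^ n)) \<and>
    (sensitive_in V (\<lambda>_. D 0) (orbit_map fs) \<longleftrightarrow>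
       sensitive_in V (iterate_domain V f) (\<lambda>n. f ^^ n))"
proof -
  note inv = orbit_map_in[OF assms(2)]
  note cont = continuous_on_orbit_map[OF assms(2,4)]
  have step: "orbit_map fs (Suc n) x = f (orbit_map fs n x)" if "x \<in> V" for n x
  proof (rule continuous_on_eq_of_dense_subset[OF cont _ _ assms(6) _ that])
    show "continuous_on V (\<lambda>x. f (orbit_map fs n x))"
      using inv by (auto intro: continuous_on_compose2[OF assms(5) cont])
    \<comment> \<open>Pointwise convergence applies at \<open>orbit_map fs n p\<close> because this
      point stays in \<open>V\<close> by \<open>inv\<close>.\<close>
    show "orbit_map fs (Suc n) p = f (orbit_map fs n p)" if "p \<in> periodic_points D fs \<inter> V" for p
      using that limit_map_periodic_orbit assms(3) inv
      unfolding periodic_points_def by blast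
  qed simp
  have eq: "orbit_map fs n x = (f ^^ n) x" if "x \<in> V" for n x
  proof (induction n)
    case (Suc n)
    then show ?case using step[OF that, of n] by (simp del: orbit_map.simps)
  qed simp
  \<comment> \<open>Although \<open>f\<close> is not assumed to map \<open>V\<close> into itself,
    its iterates on \<open>V\<close> coincide with the \<open>orbit_map\<close> values, which never
    leave \<open>V\<close>.\<close>
  have dom: "x \<in> iterate_domain V f n" if "x \<in> V" for n x
    using inv[OF that] eq[OF that] unfolding iterate_domain_def by simp
  have "V \<subseteq> D 0"
    using assms(2) unfolding totally_invariant_def by blast
  then have agree: "x \<in> D 0 \<and> x \<in> iterate_domain V f n \<and> orbit_map fs n x = (f ^^ n) x"
    if "x \<in> V" for n x
    using eq dom that by blast
  show ?thesis
    using agree topologically_transitive_in_cong[of V "\<lambda>_. D 0" "iterate_domain V f"]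
      sensitive_in_cong[of V "\<lambda>_. D 0" "iterate_domain V f"]
    by (intro conjI) simp_all
qed

end
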